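(* Let $T$ be a complete first-order theory, $\varphi(x;y)$ a formula of $T$ and $\langle P_n\rangle$ its characteristic sequence. The following are equivalent: (1) $\langle P_n\rangle$ has an $(\omega,2)$-tree. (2) $\varphi$ has $SOP_2$.
   Context: $x,y$ may be tuples of variables; parameters are drawn from a fixed sufficiently saturated (monster) model of $T$. The characteristic sequence of $\varphi$ is $P_n(z_1,\dots,z_n):=\exists x\bigwedge_{i\le n}\varphi(x;z_i)$ for $n\ge1$; $P_1$ also denotes the set it defines. Standing convention: $T\vdash \forall y\exists z\forall x(\varphi(x;z)\leftrightarrow\neg\varphi(x;y))$; if a formula $\chi(x;y)$ does not satisfy this it is replaced by $\chi(x;y)\wedge\neg\chi(x;z)$. Thus $\varphi$ either satisfies this condition or is of the form $\chi(x;y)\wedge\neg\chi(x;z)$. Write $\subseteq$ for initial segment, and $\rho i$ for the sequence $\rho$ followed by $i$. For $\lambda\ge\mu$ finite cardinals or $\omega$, $\langle P_n\rangle$ has a $(\lambda,\mu)$-tree if there exist elements $\{a_\eta:\eta\in\mu^{<\lambda}\}\subset P_1$ such that for all $\eta_1,\eta_2\in\mu^{<\lambda}$, $P_2(a_{\eta_1},a_{\eta_2})\iff(\eta_1\subseteq\eta_2\vee\eta_2\subseteq\eta_1)$; and for all $n<\omega$ and $\eta_1,\dots,\eta_n\in\mu^{<\lambda}$, $\eta_1\subseteq\dots\subseteq\eta_n\implies P_n(a_{\eta_1},\dots,a_{\eta_n})$. $\varphi$ has $SOP_2$ (also called $TP_1$, the strict tree property) if there are parameters $\{a_\eta:\eta\in\omega^{<\omega}\}$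 such that: for all $\nu\in\omega^\omega$ the set $\{\varphi(x;a_\eta):\eta\subseteq\nu\}$ is consistent; for all $\rho\in\omega^{<\omega}$ any two members of $\{\varphi(x;a_{\rho i}):i<\omega\}$ are inconsistent; and $\neg\exists x(\varphi(x;a_{\rho_1})\wedge\varphi(x;a_{\rho_2}))$ for any two $^*$incomparable $\rho_1,\rho_2\in\omega^{<\omega}$, where $\rho_1,\rho_2$ are $^*$incomparable if neither is an initial segment of the other and they are not immediate successors of the same node. *)

theory Defs
  imports "HOL-Library.Sublist" "HOL-Library.Equipollence" "HOL-Library.Extended_Nat"
begin

section \<open>First-order logic with equality\<close>

text \<open>
  The symbols of a language are subsets of types, so that, for instance, relational languages
  are included. Variables are de Bruijn indices, and environments are lists: a formula with
  parameter bound \<open>n\<close> is evaluated at an \<open>n\<close>-tuple of elements, and a quantifier adds an entry at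
  the front.
\<close>

record ('f, 'p) lang =
  funs :: "'f set"
  rels :: "'p set"
  fun_ar :: "'f \<Rightarrow> nat"
  rel_ar :: "'p \<Rightarrow> nat"

datatype 'f trm = Var nat | App 'f "'f trm list"

datatype ('f, 'p) fm =
    Top
  | Equal "'f trm" "'f trm"
  | Pred 'p "'f trm list"
  | Neg "('f, 'p) fm"
  | And "('f, 'p) fm" "('f, 'p) fm"
  | Exists "('f, 'p) fm"

definition Forall :: "('f, 'p) fm \<Rightarrow> ('f, 'p) fm" where
  "Forall \<phi> = Neg (Exists (Neg \<phi>))"

definition Iff :: "('f, 'p) fm \<Rightarrow> ('f, 'p) fm \<Rightarrow> ('f, 'p) fm" where
  "Iff \<phi> \<psi> = And (Neg (And \<phi> (Neg \<psi>))) (Neg (And \<psi> (Neg \<phi>)))"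

definition big_and :: "('f, 'p) fm list \<Rightarrow> ('f, 'p) fm" where
  "big_and \<phi>s = foldr And \<phi>s Top"

text \<open>\<open>formula L n \<phi>\<close>: \<open>\<phi>\<close> is an \<open>L\<close>-formula whose free variables are among the first \<open>n\<close>.\<close>

fun term_of_lang :: "('f, 'p) lang \<Rightarrow> nat \<Rightarrow> 'f trm \<Rightarrow> bool" where
  "term_of_lang L n (Var i) \<longleftrightarrow> i < n"
| "term_of_lang L n (App f ts) \<longleftrightarrow>
     f \<in> funs L \<and> length ts = fun_ar L f \<and> (\<forall>t\<in>set ts. term_of_lang L n t)"

fun formula :: "('f, 'p) lang \<Rightarrow> nat \<Rightarrow> ('f, 'p) fm \<Rightarrow> bool" where
  "formula L n Top \<longleftrightarrow> True"
| "formula L n (Equal s t) \<longleftrightarrow> term_of_lang L n s \<and> term_of_lang L n t"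
| "formula L n (Pred p ts) \<longleftrightarrow>
     p \<in> rels L \<and> length ts = rel_ar L p \<and> (\<forall>t\<in>set ts. term_of_lang L n t)"
| "formula L n (Neg \<phi>) \<longleftrightarrow> formula L n \<phi>"
| "formula L n (And \<phi> \<psi>) \<longleftrightarrow> formula L n \<phi> \<and> formula L n \<psi>"
| "formula L n (Exists \<phi>) \<longleftrightarrow> formula L (Suc n) \<phi>"

abbreviation sentence :: "('f, 'p) lang \<Rightarrow> ('f, 'p) fm \<Rightarrow> bool" where
  "sentence L \<equiv> formula L 0"

text \<open>Simultaneous renaming of the free variables; under a quantifier the index 0 is kept.\<close>

fun rename_trm :: "(nat \<Rightarrow> nat) \<Rightarrow> 'f trm \<Rightarrow> 'f trm" where
  "rename_trm r (Var i) = Var (r i)"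
| "rename_trm r (App f ts) = App f (map (rename_trm r) ts)"

fun rename :: "(nat \<Rightarrow> nat) \<Rightarrow> ('f, 'p) fm \<Rightarrow> ('f, 'p) fm" where
  "rename r Top = Top"
| "rename r (Equal s t) = Equal (rename_trm r s) (rename_trm r t)"
| "rename r (Pred p ts) = Pred p (map (rename_trm r) ts)"
| "rename r (Neg \<phi>) = Neg (rename r \<phi>)"
| "rename r (And \<phi> \<psi>) = And (rename r \<phi>) (rename r \<psi>)"
| "rename r (Exists \<phi>) = Exists (rename (case_nat 0 (\<lambda>i. Suc (r i))) \<phi>)"

record ('f, 'p, 'm) struct =
  univ :: "'m set"
  fun_int :: "'f \<Rightarrow> 'm list \<Rightarrow> 'm"
  rel_int :: "'p \<Rightarrow> 'm list \<Rightarrow> bool"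

definition tuples :: "('f, 'p, 'm) struct \<Rightarrow> nat \<Rightarrow> 'm list set" where
  "tuples M n = {a. length a = n \<and> set a \<subseteq> univ M}"

definition is_struct :: "('f, 'p) lang \<Rightarrow> ('f, 'p, 'm) struct \<Rightarrow> bool" where
  "is_struct L M \<longleftrightarrow> univ M \<noteq> {} \<and>
     (\<forall>f\<in>funs L. \<forall>a\<in>tuples M (fun_ar L f). fun_int M f a \<in> univ M)"

fun val :: "('f, 'p, 'm) struct \<Rightarrow> 'm list \<Rightarrow> 'f trm \<Rightarrow> 'm" where
  "val M e (Var i) = e ! i"
| "val M e (App f ts) = fun_int M f (map (val M e) ts)"

fun sat :: "('f, 'p, 'm) struct \<Rightarrow> 'm list \<Rightarrow> ('f, 'p) fm \<Rightarrow> bool" where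
  "sat M e Top \<longleftrightarrow> True"
| "sat M e (Equal s t) \<longleftrightarrow> val M e s = val M e t"
| "sat M e (Pred p ts) \<longleftrightarrow> rel_int M p (map (val M e) ts)"
| "sat M e (Neg \<phi>) \<longleftrightarrow> \<not> sat M e \<phi>"
| "sat M e (And \<phi> \<psi>) \<longleftrightarrow> sat M e \<phi> \<and> sat M e \<psi>"
| "sat M e (Exists \<phi>) \<longleftrightarrow> (\<exists>c\<in>univ M. sat M (c # e) \<phi>)"

definition is_model :: "('f, 'p) lang \<Rightarrow> ('f, 'p) fm set \<Rightarrow> ('f, 'p, 'm) struct \<Rightarrow> bool" where
  "is_model L T M \<longleftrightarrow> is_struct L M \<and> (\<forall>\<sigma>\<in>T. sat M [] \<sigma>)"

text \<open>
  HOL cannot quantify over the models of \<open>T\<close> in all types. By the downward Loewenheim-Skolem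
  theorem, consequence and satisfiability are already determined by the models of cardinality at
  most \<open>|L| + \<aleph>\<^sub>0\<close>, and every such model has an isomorphic copy whose universe is a subset of the
  type \<open>('f, 'p) fm\<close>.
\<close>

type_synonym ('f, 'p) small_struct = "('f, 'p, ('f, 'p) fm) struct"

definition entails :: "('f, 'p) lang \<Rightarrow> ('f, 'p) fm set \<Rightarrow> ('f, 'p) fm \<Rightarrow> bool" where
  "entails L T \<sigma> \<longleftrightarrow> (\<forall>N :: ('f, 'p) small_struct. is_model L T N \<longrightarrow> sat N [] \<sigma>)"

definition complete_theory :: "('f, 'p) lang \<Rightarrow> ('f, 'p) fm set \<Rightarrow> bool" where
  "complete_theory L T \<longleftrightarrow>
     (\<forall>\<sigma>\<in>T. sentence L \<sigma>) \<and>
     (\<exists>N :: ('f, 'p) small_struct. is_model L T N) \<and>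
     (\<forall>\<sigma>. sentence L \<sigma> \<longrightarrow> entails L T \<sigma> \<or> entails L T (Neg \<sigma>))"


section \<open>Types and the monster model\<close>

text \<open>
  A set of formulas with parameters in a tuple of \<open>n\<close> variables is a set of pairs \<open>(\<psi>, b)\<close>, where
  \<open>(\<psi>, b)\<close> stands for \<open>\<psi>(x\<^sub>0, \<dots>, x\<^sub>n\<^sub>-\<^sub>1; b)\<close>.
\<close>

type_synonym ('f, 'p, 'm) pfms = "(('f, 'p) fm \<times> 'm list) set"

definition pfms_over :: "('f, 'p) lang \<Rightarrow> 'm set \<Rightarrow> nat \<Rightarrow> ('f, 'p, 'm) pfms \<Rightarrow> bool" where
  "pfms_over L A n p \<longleftrightarrow> (\<forall>(\<psi>, b)\<in>p. set b \<subseteq> A \<and> formula L (n + length b) \<psi>)"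

definition realised :: "('f, 'p, 'm) struct \<Rightarrow> nat \<Rightarrow> ('f, 'p, 'm) pfms \<Rightarrow> bool" where
  "realised M n p \<longleftrightarrow> (\<exists>c\<in>tuples M n. \<forall>(\<psi>, b)\<in>p. sat M (c @ b) \<psi>)"

definition finitely_satisfiable :: "('f, 'p, 'm) struct \<Rightarrow> nat \<Rightarrow> ('f, 'p, 'm) pfms \<Rightarrow> bool" where
  "finitely_satisfiable M n p \<longleftrightarrow> (\<forall>q. q \<subseteq> p \<and> finite q \<longrightarrow> realised M n q)"

text \<open>\<open>\<kappa>\<close>-saturation, with the cardinal \<open>\<kappa>\<close> given as the cardinality of a set \<open>K\<close>.\<close>

definition saturated :: "('f, 'p) lang \<Rightarrow> 'k set \<Rightarrow> ('f, 'p, 'm) struct \<Rightarrow> bool" where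
  "saturated L K M \<longleftrightarrow>
     (\<forall>A n p. A \<subseteq> univ M \<and> A \<prec> K \<and> pfms_over L A n p \<and> finitely_satisfiable M n p
        \<longrightarrow> realised M n p)"

text \<open>
  Sufficiently saturated: \<open>\<kappa>\<close>-saturated with \<open>\<kappa> > |L| + \<aleph>\<^sub>0\<close>.
\<close>

definition monster ::
    "('f, 'p) lang \<Rightarrow> ('f, 'p) fm set \<Rightarrow> 'k set \<Rightarrow> ('f, 'p, 'm) struct \<Rightarrow> bool" where
  "monster L T K M \<longleftrightarrow>
     is_model L T M \<and> (UNIV :: nat set) \<prec> K \<and> funs L \<prec> K \<and> rels L \<prec> K \<and> saturated L K M"

text \<open>
  Consistency of a set of formulas over a small set of parameters means, as usual in a monster
  model, that it is realised there. By saturation this agrees with finite satisfiability.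
\<close>

abbreviation consistent :: "('f, 'p, 'm) struct \<Rightarrow> nat \<Rightarrow> ('f, 'p, 'm) pfms \<Rightarrow> bool" where
  "consistent \<equiv> realised"

lemma consistent_iff_finitely_satisfiable:
  assumes "monster L T K M" "A \<subseteq> univ M" "A \<prec> K" "pfms_over L A n p"
  shows "consistent M n p \<longleftrightarrow> finitely_satisfiable M n p"
proof
  assume "consistent M n p"
  then show "finitely_satisfiable M n p"
    unfolding finitely_satisfiable_def realised_def by blast
next
  assume "finitely_satisfiable M n p"
  with assms show "consistent M n p"
    unfolding monster_def saturated_def by blast
qed


section \<open>The characteristic sequence\<close>

text \<open>
  A formula \<open>\<phi>(x; y)\<close> with \<open>k = |x|\<close> and \<open>m = |y|\<close> is a formula with free variables below \<open>k + m\<close>,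
  the first \<open>k\<close> of which are \<open>x\<close>. With \<open>x\<close> followed by a sequence of tuples of length \<open>m\<close>,
  \<open>at_block k m i \<phi>\<close> is \<open>\<phi>(x; z)\<close> for the tuple \<open>z\<close> with number \<open>i\<close>, counted from 0.
\<close>

definition at_block :: "nat \<Rightarrow> nat \<Rightarrow> nat \<Rightarrow> ('f, 'p) fm \<Rightarrow> ('f, 'p) fm" where
  "at_block k m i \<phi> = rename (\<lambda>j. if j < k then j else j + i * m) \<phi>"

text \<open>\<open>P\<^sub>n(z\<^sub>1, \<dots>, z\<^sub>n) = \<exists>x. \<And>\<^sub>i \<phi>(x; z\<^sub>i)\<close>, and its interpretation in \<open>M\<close> for \<open>n \<ge> 1\<close>.\<close>

definition char_fm :: "nat \<Rightarrow> nat \<Rightarrow> ('f, 'p) fm \<Rightarrow> nat \<Rightarrow> ('f, 'p) fm" where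
  "char_fm k m \<phi> n = (Exists ^^ k) (big_and (map (\<lambda>i. at_block k m i \<phi>) [0..<n]))"

definition char_seq ::
    "('f, 'p, 'm) struct \<Rightarrow> nat \<Rightarrow> nat \<Rightarrow> ('f, 'p) fm \<Rightarrow> nat \<Rightarrow> 'm list list \<Rightarrow> bool" where
  "char_seq M k m \<phi> n bs \<longleftrightarrow>
     1 \<le> n \<and> length bs = n \<and> set bs \<subseteq> tuples M m \<and> sat M (concat bs) (char_fm k m \<phi> n)"

text \<open>
  \<open>T \<turnstile> \<forall>y \<exists>z \<forall>x (\<phi>(x; z) \<longleftrightarrow> \<not> \<phi>(x; y))\<close>. The innermost quantifiers own the smallest indices, so the
  matrix sees \<open>x\<close>, then \<open>z\<close> (block 0), then \<open>y\<close> (block 1).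
\<close>

definition closed_under_negation ::
    "('f, 'p) lang \<Rightarrow> ('f, 'p) fm set \<Rightarrow> nat \<Rightarrow> nat \<Rightarrow> ('f, 'p) fm \<Rightarrow> bool" where
  "closed_under_negation L T k m \<phi> \<longleftrightarrow>
     entails L T ((Forall ^^ m) ((Exists ^^ m) ((Forall ^^ k)
       (Iff (at_block k m 0 \<phi>) (Neg (at_block k m 1 \<phi>))))))"

text \<open>
  Formulas \<open>\<chi>(x; y)\<close> that are not closed under negation in the above sense are replaced by
  \<open>\<chi>(x; y) \<and> \<not> \<chi>(x; z)\<close>, so every \<open>\<phi>\<close> is of one of these two kinds. In the second case its
  parameter tuple is the concatenation of \<open>y\<close> and \<open>z\<close>.
\<close>

definition standing_convention ::
    "('f, 'p) lang \<Rightarrow> ('f, 'p) fm set \<Rightarrow> nat \<Rightarrow> nat \<Rightarrow> ('f, 'p) fm \<Rightarrow> bool" where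
  "standing_convention L T k m \<phi> \<longleftrightarrow>
     closed_under_negation L T k m \<phi> \<or>
     (\<exists>l \<chi>. m = 2 * l \<and> formula L (k + l) \<chi> \<and>
        \<phi> = And (at_block k l 0 \<chi>) (Neg (at_block k l 1 \<chi>)))"

text \<open>The de Bruijn encodings above have the intended meaning.\<close>

lemma val_rename:
  assumes "term_of_lang L n t" "\<And>i. i < n \<Longrightarrow> e' ! r i = e ! i"
  shows "val M e' (rename_trm r t) = val M e t"
  using assms by (induction L n t rule: term_of_lang.induct) (auto cong: map_cong simp: o_def)

lemma sat_rename:
  assumes "formula L n \<phi>" "\<And>i. i < n \<Longrightarrow> e' ! r i = e ! i"
  shows "sat M e' (rename r \<phi>) \<longleftrightarrow> sat M e \<phi>"
  using assms
proof (induction L n \<phi> arbitrary: r e e' rule: formula.induct)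
  case (2 L n s t)
  then show ?case by (simp add: val_rename[of L n])
next
  case (3 L n p ts)
  then have "map (val M e') (map (rename_trm r) ts) = map (val M e) ts"
    by (auto intro: val_rename[of L n])
  then show ?case by (simp only: rename.simps sat.simps)
next
  case (6 L n \<phi>)
  have "sat M (c # e') (rename (case_nat 0 (\<lambda>i. Suc (r i))) \<phi>) \<longleftrightarrow> sat M (c # e) \<phi>" for c
    using 6 by (intro "6.IH") (auto split: nat.split)
  then show ?case by simp
next
  case (5 L n \<phi> \<psi>)
  then show ?case by (metis formula.simps(5) rename.simps(5) sat.simps(5))
qed auto

lemma sat_Exists_funpow: "sat M e ((Exists ^^ k) \<phi>) \<longleftrightarrow> (\<exists>c\<in>tuples M k. sat M (c @ e) \<phi>)"
proof (induction k arbitrary: e)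
  case (Suc k)
  have "sat M e ((Exists ^^ Suc k) \<phi>) \<longleftrightarrow> (\<exists>d\<in>univ M. \<exists>c\<in>tuples M k. sat M ((c @ [d]) @ e) \<phi>)"
    by (simp add: Suc)
  also have "\<dots> \<longleftrightarrow> (\<exists>c\<in>tuples M (Suc k). sat M (c @ e) \<phi>)"
  proof safe
    fix d c
    assume "d \<in> univ M" "c \<in> tuples M k" "sat M ((c @ [d]) @ e) \<phi>"
    then show "\<exists>c\<in>tuples M (Suc k). sat M (c @ e) \<phi>"
      by (intro bexI[of _ "c @ [d]"]) (auto simp: tuples_def)
  next
    fix c
    assume c: "c \<in> tuples M (Suc k)" "sat M (c @ e) \<phi>"
    then have "c \<noteq> []" by (auto simp: tuples_def)
    then obtain c' d where "c = c' @ [d]" by (meson rev_exhaust)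
    with c show "\<exists>d\<in>univ M. \<exists>c\<in>tuples M k. sat M ((c @ [d]) @ e) \<phi>"
      by (intro bexI[of _ d] bexI[of _ c']) (auto simp: tuples_def)
  qed
  finally show ?case .
qed (auto simp: tuples_def)

lemma sat_Forall_funpow: "sat M e ((Forall ^^ k) \<phi>) \<longleftrightarrow> (\<forall>c\<in>tuples M k. sat M (c @ e) \<phi>)"
proof -
  have "sat M e ((Forall ^^ k) \<phi>) \<longleftrightarrow> \<not> sat M e ((Exists ^^ k) (Neg \<phi>))" for e
    by (induction k arbitrary: e) (auto simp: Forall_def)
  then show ?thesis by (simp add: sat_Exists_funpow)
qed

lemma nth_concat_block:
  assumes "\<And>b. b \<in> set bs \<Longrightarrow> length b = m" "i < length bs" "j < m"
  shows "concat bs ! (i * m + j) = bs ! i ! j"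
  using assms
proof (induction bs arbitrary: i)
  case (Cons b bs)
  then show ?case by (cases i) (auto simp: nth_append)
qed simp

lemma sat_at_block:
  assumes "formula L (k + m) \<phi>" "length c = k" "\<And>b. b \<in> set bs \<Longrightarrow> length b = m" "i < length bs"
  shows "sat M (c @ concat bs) (at_block k m i \<phi>) \<longleftrightarrow> sat M (c @ bs ! i) \<phi>"
  unfolding at_block_def
proof (rule sat_rename[OF assms(1)])
  fix j assume "j < k + m"
  have "concat bs ! (i * m + (j - k)) = bs ! i ! (j - k)" if "k \<le> j"
    using that \<open>j < k + m\<close> by (intro nth_concat_block assms) auto
  then show "(c @ concat bs) ! (if j < k then j else j + i * m) = (c @ bs ! i) ! j"
    using assms(2) by (auto simp: nth_append add.commute)
qed

lemma sat_big_and: "sat M e (big_and \<phi>s) \<longleftrightarrow> (\<forall>\<phi>\<in>set \<phi>s. sat M e \<phi>)"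
  unfolding big_and_def by (induction \<phi>s) auto

lemma char_seq_iff:
  assumes "formula L (k + m) \<phi>"
  shows "char_seq M k m \<phi> n bs \<longleftrightarrow>
     1 \<le> n \<and> length bs = n \<and> set bs \<subseteq> tuples M m \<and>
     (\<exists>c\<in>tuples M k. \<forall>b\<in>set bs. sat M (c @ b) \<phi>)"
proof -
  have "sat M (c @ concat bs) (big_and (map (\<lambda>i. at_block k m i \<phi>) [0..<length bs])) \<longleftrightarrow>
      (\<forall>b\<in>set bs. sat M (c @ b) \<phi>)" if "c \<in> tuples M k" "set bs \<subseteq> tuples M m" for c
  proof -
    have "sat M (c @ concat bs) (at_block k m i \<phi>) \<longleftrightarrow> sat M (c @ bs ! i) \<phi>"
      if "i < length bs" for i
      using that \<open>c \<in> _\<close> \<open>set bs \<subseteq> _\<close>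
      by (intro sat_at_block[OF assms]) (auto simp: tuples_def)
    then show ?thesis
      by (auto simp: sat_big_and all_set_conv_all_nth)
  qed
  then show ?thesis
    by (auto simp: char_seq_def char_fm_def sat_Exists_funpow)
qed

lemma closed_under_negation_iff:
  fixes L :: "('f, 'p) lang"
  assumes "formula L (k + m) \<phi>"
  shows "closed_under_negation L T k m \<phi> \<longleftrightarrow>
     (\<forall>N :: ('f, 'p) small_struct. is_model L T N \<longrightarrow>
        (\<forall>b\<in>tuples N m. \<exists>d\<in>tuples N m. \<forall>c\<in>tuples N k.
           sat N (c @ d) \<phi> \<longleftrightarrow> \<not> sat N (c @ b) \<phi>))"
proof -
  have "sat N (c @ d @ b) (Iff (at_block k m 0 \<phi>) (Neg (at_block k m 1 \<phi>))) \<longleftrightarrow>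
      (sat N (c @ d) \<phi> \<longleftrightarrow> \<not> sat N (c @ b) \<phi>)"
    if "b \<in> tuples N m" "d \<in> tuples N m" "c \<in> tuples N k" for N :: "('f, 'p) small_struct" and b c d
    using sat_at_block[OF assms, of c "[d, b]" 0 N] sat_at_block[OF assms, of c "[d, b]" 1 N] that
    by (auto simp: Iff_def tuples_def)
  then show ?thesis
    by (simp add: closed_under_negation_def entails_def sat_Forall_funpow sat_Exists_funpow cong: bex_cong ball_cong)
qed


section \<open>Trees and SOP2\<close>

text \<open>\<open>\<mu>\<^bsup><\<theta>\<^esup>\<close> for \<open>\<theta>, \<mu> \<le> \<omega>\<close>.\<close>

definition tree_nodes :: "enat \<Rightarrow> enat \<Rightarrow> nat list set" where
  "tree_nodes \<theta> \<mu> = {\<eta>. enat (length \<eta>) < \<theta> \<and> (\<forall>i\<in>set \<eta>. enat i < \<mu>)}"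

definition has_tree :: "(nat \<Rightarrow> 'b list \<Rightarrow> bool) \<Rightarrow> enat \<Rightarrow> enat \<Rightarrow> bool" where
  "has_tree P \<theta> \<mu> \<longleftrightarrow> \<mu> \<le> \<theta> \<and>
     (\<exists>a :: nat list \<Rightarrow> 'b.
        (\<forall>\<eta>\<in>tree_nodes \<theta> \<mu>. P 1 [a \<eta>]) \<and>
        (\<forall>\<eta>\<^sub>1\<in>tree_nodes \<theta> \<mu>. \<forall>\<eta>\<^sub>2\<in>tree_nodes \<theta> \<mu>.
           P 2 [a \<eta>\<^sub>1, a \<eta>\<^sub>2] \<longleftrightarrow> prefix \<eta>\<^sub>1 \<eta>\<^sub>2 \<or> prefix \<eta>\<^sub>2 \<eta>\<^sub>1) \<and>
        (\<forall>n\<ge>1. \<forall>\<eta>s. length \<eta>s = n \<and> set \<eta>s \<subseteq> tree_nodes \<theta> \<mu> \<and> sorted_wrt prefix \<eta>s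
           \<longrightarrow> P n (map a \<eta>s)))"

definition initial_segment :: "nat list \<Rightarrow> (nat \<Rightarrow> nat) \<Rightarrow> bool" where
  "initial_segment \<eta> \<nu> \<longleftrightarrow> \<eta> = map \<nu> [0..<length \<eta>]"

definition star_incomparable :: "nat list \<Rightarrow> nat list \<Rightarrow> bool" where
  "star_incomparable \<rho>\<^sub>1 \<rho>\<^sub>2 \<longleftrightarrow>
     \<not> prefix \<rho>\<^sub>1 \<rho>\<^sub>2 \<and> \<not> prefix \<rho>\<^sub>2 \<rho>\<^sub>1 \<and> \<not> (\<exists>\<rho> i j. \<rho>\<^sub>1 = \<rho> @ [i] \<and> \<rho>\<^sub>2 = \<rho> @ [j])"

definition SOP2 :: "('f, 'p, 'm) struct \<Rightarrow> nat \<Rightarrow> nat \<Rightarrow> ('f, 'p) fm \<Rightarrow> bool" where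
  "SOP2 M k m \<phi> \<longleftrightarrow>
     (\<exists>a :: nat list \<Rightarrow> 'm list.
        (\<forall>\<eta>. a \<eta> \<in> tuples M m) \<and>
        (\<forall>\<nu>. consistent M k {(\<phi>, a \<eta>) |\<eta>. initial_segment \<eta> \<nu>}) \<and>
        (\<forall>\<rho> i j. i \<noteq> j \<longrightarrow> \<not> consistent M k {(\<phi>, a (\<rho> @ [i])), (\<phi>, a (\<rho> @ [j]))}) \<and>
        (\<forall>\<rho>\<^sub>1 \<rho>\<^sub>2. star_incomparable \<rho>\<^sub>1 \<rho>\<^sub>2 \<longrightarrow>
           \<not> (\<exists>c\<in>tuples M k. sat M (c @ a \<rho>\<^sub>1) \<phi> \<and> sat M (c @ a \<rho>\<^sub>2) \<phi>)))"

end

theory Submission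
  imports Defs
begin

text \<open>
  Siblings are incomparable, and two incomparable nodes are either siblings or *incomparable.
  Hence SOP2 says just this: there is a family indexed by \<open>\<omega>\<^bsup><\<omega>\<^esup>\<close> whose branches are
  consistent and in which any two incomparable nodes are inconsistent (\<open>SOP2_iff\<close>). A binary tree
  differs from this in two respects only, the branching and the fact that it speaks about finite
  chains instead of branches.

  From SOP2 to the binary tree one restricts the family to \<open>2\<^bsup><\<omega>\<^esup>\<close>; a finite chain lies on a
  branch. Conversely, \<open>\<omega>\<^bsup><\<omega>\<^esup>\<close> embeds into \<open>2\<^bsup><\<omega>\<^esup>\<close> by sending each entry \<open>i\<close> to the block
  \<open>0\<^sup>i1\<close>. These blocks form a prefix code, so that the embedding preserves and reflects the
  relation of being an initial segment (\<open>prefix_unary_code_iff\<close>), and pulling back the binary tree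
  along it gives the required family. Its finite chains are consistent; since a branch has only
  countably many parameters, saturation makes whole branches consistent
  (\<open>countable_consistent_if_finite\<close>).
\<close>

section \<open>Embedding the infinitely branching tree into the binary tree\<close>

definition unary_code :: "nat list \<Rightarrow> nat list" where
  "unary_code \<eta> = concat (map (\<lambda>i. replicate i 0 @ [1]) \<eta>)"

lemma prefix_unary_block_iff:
  "prefix (replicate i 0 @ (1::nat) # u) (replicate j 0 @ 1 # v) \<longleftrightarrow> i = j \<and> prefix u v"
proof (induction i arbitrary: j)
  case 0
  then show ?case by (cases j) auto
next
  case (Suc i)
  then show ?case by (cases j) auto
qed

lemma prefix_unary_code_iff: "prefix (unary_code \<eta>) (unary_code \<rho>) \<longleftrightarrow> prefix \<eta> \<rho>"
proof (induction \<eta> arbitrary: \<rho>)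
  case Nil
  then show ?case by (simp add: unary_code_def)
next
  case (Cons i \<eta>)
  show ?case
  proof (cases \<rho>)
    case Nil
    then show ?thesis by (simp add: unary_code_def)
  next
    case (Cons j \<rho>')
    then show ?thesis
      using Cons.IH[of \<rho>'] prefix_unary_block_iff[of i "unary_code \<eta>" j "unary_code \<rho>'"]
      by (simp add: unary_code_def)
  qed
qed

lemma tree_nodes_binary: "tree_nodes \<infinity> 2 = {\<eta>. \<forall>i\<in>set \<eta>. i < 2}"
  by (simp add: tree_nodes_def numeral_eq_enat)

lemma unary_code_in_tree_nodes: "unary_code \<eta> \<in> tree_nodes \<infinity> 2"
  by (auto simp: tree_nodes_binary unary_code_def)


section \<open>Branches and chains\<close>

lemma branch_conv_range:
  "{(\<phi>, a \<eta>) |\<eta>. initial_segment \<eta> \<nu>} = range (\<lambda>j. (\<phi>, a (map \<nu> [0..<j])))"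
proof (intro equalityI subsetI)
  fix x assume "x \<in> {(\<phi>, a \<eta>) |\<eta>. initial_segment \<eta> \<nu>}"
  then obtain \<eta> where "x = (\<phi>, a \<eta>)" "\<eta> = map \<nu> [0..<length \<eta>]"
    by (auto simp: initial_segment_def)
  then show "x \<in> range (\<lambda>j. (\<phi>, a (map \<nu> [0..<j])))"
    by (metis rangeI)
qed (auto simp: initial_segment_def)

lemma prefix_map_upt: "i \<le> j \<Longrightarrow> prefix (map f [0..<i]) (map f [0..<j])"
  by (metis le_add_diff_inverse map_append prefixI upt_add_eq_append zero_le)

lemma sorted_wrt_prefix_branch: "sorted_wrt prefix (map (\<lambda>j. map \<nu> [0..<j]) [0..<n])"
  by (auto simp: sorted_wrt_iff_nth_less intro: prefix_map_upt)

text \<open>The branch continues the last node of the chain by zeros.\<close>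

lemma chain_in_branch:
  assumes "sorted_wrt prefix \<eta>s"
  shows "\<exists>\<nu>. \<forall>\<eta>\<in>set \<eta>s. initial_segment \<eta> \<nu>"
proof (cases "\<eta>s = []")
  case False
  let ?\<mu> = "last \<eta>s"
  let ?\<nu> = "\<lambda>i. if i < length ?\<mu> then ?\<mu> ! i else 0"
  have "initial_segment \<eta> ?\<nu>" if "\<eta> \<in> set \<eta>s" for \<eta>
  proof -
    have "\<forall>\<eta>\<in>set (butlast \<eta>s). prefix \<eta> ?\<mu>"
      using assms False by (metis append_butlast_last_id list.set_intros(1) sorted_wrt_append)
    then have "prefix \<eta> ?\<mu>"
      using that False
      by (metis append_butlast_last_id in_set_conv_nth butlast_snoc in_set_butlastD prefix_order.refl UnE set_append empty_iff empty_set set_ConsD)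
    then obtain \<zeta> where "?\<mu> = \<eta> @ \<zeta>" by (rule prefixE)
    then show ?thesis
      by (auto simp: initial_segment_def nth_append intro!: nth_equalityI)
  qed
  then show ?thesis by blast
qed simp

text \<open>
  Saturation applies because the cardinal of \<open>K\<close> is uncountable, so that countably many parameters
  are few.
\<close>

lemma countable_consistent_if_finite:
  fixes b :: "nat \<Rightarrow> 'm list"
  assumes "monster L T K M" "formula L (k + m) \<phi>" "\<And>j. b j \<in> tuples M m"
    and fin: "\<And>n. \<exists>c\<in>tuples M k. \<forall>j<n. sat M (c @ b j) \<phi>"
  shows "consistent M k (range (\<lambda>j. (\<phi>, b j)))"
proof -
  let ?p = "range (\<lambda>j. (\<phi>, b j))" and ?A = "\<Union>j. set (b j)"
  have "countable ?A"
    by (simp add: countable_finite)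
  then have "?A \<lesssim> (UNIV :: nat set)"
    by (auto simp: countable_def lepoll_def)
  then have "?A \<prec> K"
    using assms(1) unfolding monster_def by (meson lesspoll_trans1)
  moreover have "?A \<subseteq> univ M"
    using assms(3) by (auto simp: tuples_def)
  moreover have "pfms_over L ?A k ?p"
    using assms(2,3) by (auto simp: pfms_over_def tuples_def)
  moreover have "finitely_satisfiable M k ?p"
    unfolding finitely_satisfiable_def
  proof (intro allI impI)
    fix q assume q: "q \<subseteq> ?p \<and> finite q"
    then obtain J where J: "finite J" "q = (\<lambda>j. (\<phi>, b j)) ` J"
      by (meson finite_subset_image)
    then obtain n where "\<forall>j\<in>J. j < n"
      by (meson finite_nat_set_iff_bounded)
    with fin[of n] J show "realised M k q"
      unfolding realised_def by auto
  qed
  ultimately show ?thesis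
    using assms(1) by (simp add: consistent_iff_finitely_satisfiable)
qed


section \<open>Strict trees\<close>

text \<open>
  The definition of SOP2 treats pairs of siblings and *incomparable pairs separately; together
  these are exactly the incomparable pairs.
\<close>

lemma SOP2_iff:
  assumes "formula L (k + m) \<phi>"
  shows "SOP2 M k m \<phi> \<longleftrightarrow> (\<exists>a :: nat list \<Rightarrow> _.
     (\<forall>\<eta>. a \<eta> \<in> tuples M m) \<and>
     (\<forall>\<nu>. consistent M k (range (\<lambda>j. (\<phi>, a (map \<nu> [0..<j]))))) \<and>
     (\<forall>\<eta> \<rho>. \<not> prefix \<eta> \<rho> \<and> \<not> prefix \<rho> \<eta> \<longrightarrow> \<not> char_seq M k m \<phi> 2 [a \<eta>, a \<rho>]))"
  (is "_ \<longleftrightarrow> (\<exists>a. ?tup a \<and> ?br a \<and> ?inc a)")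
proof -
  have inconsistent: "(\<forall>\<rho> i j. i \<noteq> j \<longrightarrow> \<not> consistent M k {(\<phi>, a (\<rho> @ [i])), (\<phi>, a (\<rho> @ [j]))}) \<and>
        (\<forall>\<rho>\<^sub>1 \<rho>\<^sub>2. star_incomparable \<rho>\<^sub>1 \<rho>\<^sub>2 \<longrightarrow>
           \<not> (\<exists>c\<in>tuples M k. sat M (c @ a \<rho>\<^sub>1) \<phi> \<and> sat M (c @ a \<rho>\<^sub>2) \<phi>)) \<longleftrightarrow> ?inc a"
    (is "?sib \<and> ?star \<longleftrightarrow> _") if "?tup a" for a :: "nat list \<Rightarrow> _"
  proof -
    have pair: "consistent M k {(\<phi>, a \<eta>), (\<phi>, a \<rho>)} \<longleftrightarrow> char_seq M k m \<phi> 2 [a \<eta>, a \<rho>]"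
      "(\<exists>c\<in>tuples M k. sat M (c @ a \<eta>) \<phi> \<and> sat M (c @ a \<rho>) \<phi>) \<longleftrightarrow> char_seq M k m \<phi> 2 [a \<eta>, a \<rho>]"
      for \<eta> \<rho>
      using that by (auto simp: realised_def char_seq_iff[OF assms])
    have incomparable: "(\<not> prefix \<eta> \<rho> \<and> \<not> prefix \<rho> \<eta>) \<longleftrightarrow>
        star_incomparable \<eta> \<rho> \<or> (\<exists>\<zeta> i j. i \<noteq> j \<and> \<eta> = \<zeta> @ [i] \<and> \<rho> = \<zeta> @ [j])" for \<eta> \<rho>
      unfolding star_incomparable_def by auto
    show ?thesis
      unfolding pair incomparable by auto
  qed
  show ?thesis
    unfolding SOP2_def branch_conv_range
    by (intro arg_cong[of _ _ Ex] ext conj_cong refl inconsistent)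
qed

lemma SOP2_if_tree:
  assumes "monster L T K M" and \<phi>: "formula L (k + m) \<phi>"
    and tree: "has_tree (char_seq M k m \<phi>) \<infinity> 2"
  shows "SOP2 M k m \<phi>"
proof -
  let ?N = "tree_nodes \<infinity> 2"
  obtain a where a1: "\<And>\<eta>. \<eta> \<in> ?N \<Longrightarrow> char_seq M k m \<phi> 1 [a \<eta>]"
    and a2: "\<And>\<eta> \<rho>. \<eta> \<in> ?N \<Longrightarrow> \<rho> \<in> ?N \<Longrightarrow>
      char_seq M k m \<phi> 2 [a \<eta>, a \<rho>] \<longleftrightarrow> prefix \<eta> \<rho> \<or> prefix \<rho> \<eta>"
    and an: "\<And>\<eta>s. 1 \<le> length \<eta>s \<Longrightarrow> set \<eta>s \<subseteq> ?N \<Longrightarrow> sorted_wrt prefix \<eta>s \<Longrightarrow>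
      char_seq M k m \<phi> (length \<eta>s) (map a \<eta>s)"
    using tree unfolding has_tree_def by blast
  let ?a = "\<lambda>\<eta>. a (unary_code \<eta>)"
  have tup: "?a \<eta> \<in> tuples M m" for \<eta>
    using a1[OF unary_code_in_tree_nodes] by (simp add: char_seq_iff[OF \<phi>])
  have "consistent M k (range (\<lambda>j. (\<phi>, ?a (map \<nu> [0..<j]))))" for \<nu>
  proof (rule countable_consistent_if_finite[OF assms(1) \<phi> tup])
    fix n
    \<comment> \<open>Length \<open>n + 1\<close>, because a chain must not be empty.\<close>
    let ?\<eta>s = "map (\<lambda>j. unary_code (map \<nu> [0..<j])) [0..<Suc n]"
    have "sorted_wrt prefix ?\<eta>s"
      using sorted_wrt_prefix_branch[of \<nu> "Suc n"]
      by (simp only: sorted_wrt_map prefix_unary_code_iff)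
    moreover have "set ?\<eta>s \<subseteq> ?N"
      using unary_code_in_tree_nodes by auto
    ultimately have "char_seq M k m \<phi> (length ?\<eta>s) (map a ?\<eta>s)"
      by (intro an) auto
    then show "\<exists>c\<in>tuples M k. \<forall>j<n. sat M (c @ ?a (map \<nu> [0..<j])) \<phi>"
      unfolding char_seq_iff[OF \<phi>] by force
  qed
  moreover have "\<not> char_seq M k m \<phi> 2 [?a \<eta>, ?a \<rho>]"
    if "\<not> prefix \<eta> \<rho> \<and> \<not> prefix \<rho> \<eta>" for \<eta> \<rho>
    using that by (simp add: a2 unary_code_in_tree_nodes prefix_unary_code_iff)
  ultimately show ?thesis
    unfolding SOP2_iff[OF \<phi>] using tup by (intro exI[of _ ?a]) blast
qed

lemma tree_if_SOP2:
  assumes \<phi>: "formula L (k + m) \<phi>" and "SOP2 M k m \<phi>"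
  shows "has_tree (char_seq M k m \<phi>) \<infinity> 2"
proof -
  obtain a :: "nat list \<Rightarrow> _" where tup: "\<And>\<eta>. a \<eta> \<in> tuples M m"
    and branch: "\<And>\<nu>. consistent M k (range (\<lambda>j. (\<phi>, a (map \<nu> [0..<j]))))"
    and inc: "\<And>\<eta> \<rho>. \<not> prefix \<eta> \<rho> \<Longrightarrow> \<not> prefix \<rho> \<eta> \<Longrightarrow> \<not> char_seq M k m \<phi> 2 [a \<eta>, a \<rho>]"
    using assms(2) unfolding SOP2_iff[OF \<phi>] by blast
  have chain: "char_seq M k m \<phi> (length \<eta>s) (map a \<eta>s)"
    if nonempty: "1 \<le> length \<eta>s" and sorted: "sorted_wrt prefix \<eta>s" for \<eta>s
  proof -
    obtain \<nu> where \<nu>: "\<forall>\<eta>\<in>set \<eta>s. initial_segment \<eta> \<nu>"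
      using chain_in_branch[OF sorted] by blast
    obtain c where c: "c \<in> tuples M k" "\<And>j. sat M (c @ a (map \<nu> [0..<j])) \<phi>"
      using branch[of \<nu>] by (auto simp: realised_def)
    have "sat M (c @ a \<eta>) \<phi>" if "\<eta> \<in> set \<eta>s" for \<eta>
      using c(2)[of "length \<eta>"] \<nu> that by (simp add: initial_segment_def)
    then show ?thesis
      using nonempty c(1) tup by (auto simp: char_seq_iff[OF \<phi>])
  qed
  have "char_seq M k m \<phi> 1 [a \<eta>]" for \<eta>
    using chain[of "[\<eta>]"] by simp
  moreover have "char_seq M k m \<phi> 2 [a \<eta>, a \<rho>] \<longleftrightarrow> prefix \<eta> \<rho> \<or> prefix \<rho> \<eta>" for \<eta> \<rho>
  proof
    assume "prefix \<eta> \<rho> \<or> prefix \<rho> \<eta>"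
    moreover have "char_seq M k m \<phi> 2 [a \<eta>, a \<rho>] \<longleftrightarrow> char_seq M k m \<phi> 2 [a \<rho>, a \<eta>]"
      by (auto simp: char_seq_iff[OF \<phi>])
    ultimately show "char_seq M k m \<phi> 2 [a \<eta>, a \<rho>]"
      using chain[of "[\<eta>, \<rho>]"] chain[of "[\<rho>, \<eta>]"] by (auto simp: numeral_2_eq_2)
  qed (use inc in blast)
  ultimately show ?thesis
    unfolding has_tree_def using chain by (auto intro!: exI[of _ a])
qed

theorem claim4p7:
  fixes L :: "('f, 'p) lang" and T :: "('f, 'p) fm set"
    and K :: "'k set" and M :: "('f, 'p, 'm) struct"
    and k m :: nat and \<phi> :: "('f, 'p) fm"
  assumes "complete_theory L T"
    and "monster L T K M"
    and "formula L (k + m) \<phi>"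
    and "standing_convention L T k m \<phi>"
  shows "has_tree (char_seq M k m \<phi>) \<infinity> 2 \<longleftrightarrow> SOP2 M k m \<phi>"
  using SOP2_if_tree[OF assms(2,3)] tree_if_SOP2[OF assms(3)] by blast

end
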